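(* Let problems $q=1,\dots,K$ (with common number of levels $L$) be given, each satisfying: (existence) its feasible set is compact, the minima in its lexicographic cascade are attained, its performance objective has a minimizer on the final cascade set, and its weighted-sum problem has a minimizer for every $w\in\mathbb R_{++}^L$; (uniqueness) its lexicographic optimum is unique; (convexity) its feasible set, constraint functions and performance objective are convex. Let $p_q^\star$ be the lexicographic image point of problem $q$ and define the robust region $$\Omega_{\mathrm{rob}}=\bigcap_{q=1}^K\Omega(p_q^\star).$$ If $w\in\Omega_{\mathrm{rob}}$, then for every $q$ the lexicographic optimum of problem $q$ minimizes its weighted-sum objective at weight $w$. Moreover, $\Omega_{\mathrm{rob}}$ is a polyhedron (within the open positive orthant) whenever each $\Omega(p_q^\star)$ is. This is the case when, for each $q$, the feasible set is polyhedral, the constraint functions are affine, the violation functionals are hinge sums ($p=1$), and the performance objective is either convex piecewise affine or convex and differentiable near the feasible set. The Chebyshev centre of $\Omega_{\mathrm{rob}}$ is then computed by a single linear program once the half-space descriptions of the $\Omega(p_q^\star)$ are available.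
   Context: A priority-ordered problem with $L$ levels consists of a feasible set $\mathcal Z\subset\mathbb R^d$, a performance objective $J:\mathbb R^d\to\mathbb R$ and constraint functions $g_{i,j}:\mathbb R^d\to\mathbb R$ ($1\le i\le L$, $1\le j\le m_i$). With $[a]_+=\max(0,a)$ and fixed $p\in\{1,2\}$, $V_i(z)=\sum_{j}[g_{i,j}(z)]_+^p$. Lexicographic cascade: $\mathcal F_0=\mathcal Z$, and for $i=1,\dots,L$, $V_i^\star=\min_{z\in\mathcal F_{i-1}}V_i(z)$, $\mathcal F_i=\{z\in\mathcal F_{i-1}:V_i(z)=V_i^\star\}$. The lexicographic optimum is $z^\star_{\mathrm{lex}}\in\arg\min_{z\in\mathcal F_L}J(z)$, with $J^\star=J(z^\star_{\mathrm{lex}})$ and image $p^\star=(V_1^\star,\dots,V_L^\star,J^\star)\in\mathbb R^{L+1}$. The weighted-sum objective at weight $w\in\mathbb R_{++}^L=(0,\infty)^L$ is $J+\sum_iw_iV_i$, minimized over $\mathcal Z$. Upper image: $\overline{\mathcal P}=\mathrm{cl}\{(y,t)\in\mathbb R^{L}\times\mathbb R:\exists z\in\mathcal Z,\ V_i(z)\le y_i\ \forall i,\ J(z)\le t\}$. Outward normal cone (in the paper's sign convention): $N^+_{\overline{\mathcal P}}(p^\star)=\{\eta\in\mathbb R^{L+1}:\langle\eta,q'-p^\star\rangle\ge0\ \forall q'\in\overline{\mathcal P}\}$. Equivalence region: $\Omega(p^\star)=\{w\in\mathbb R_{++}^L:(w,1)\in N^+_{\overline{\mathcal P}}(p^\star)\}$;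 $\Omega(p_q^\star)$ is this region formed with the data of problem $q$. "Polyhedron" for such regions means a set $\{w\in\mathbb R_{++}^L:Cw\le d_0,\ Ew=f\}$ (a half-space description). Its Chebyshev centre (taken within a prescribed box $\prod_i[\underline w_i,\overline w_i]$, $\underline w_i>0$) is a point $w$ satisfying $Ew=f$ that maximizes the radius $r\ge0$ of the ball about $w$ satisfying all the inequality constraints $Cw\le d_0$ and the box constraints. *)

theory Defs
  imports "HOL-Analysis.Analysis"
begin

(* The levels 1, ..., L are the elements of a finite linearly ordered type 'l, listed from the
   highest priority (least element) to the lowest, so L = CARD('l) and R^L is real^'l. *)

definition level_no :: "'l::{finite,linorder} \<Rightarrow> nat"
  where "level_no l = card {..l}"

definition level :: "nat \<Rightarrow> 'l::{finite,linorder}"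
  where "level = inv level_no"

lemma inj_level_no: "inj (level_no :: 'l::{finite,linorder} \<Rightarrow> nat)"
proof (rule injI)
  fix k l :: 'l
  assume eq: "level_no k = level_no l"
  have *: "level_no a < level_no b" if "a < b" for a b :: 'l
    unfolding level_no_def using that by (intro psubset_card_mono) auto
  show "k = l"
    using eq *[of k l] *[of l k] by (cases k l rule: linorder_cases) auto
qed

lemma bij_level_no: "bij_betw (level_no :: 'l::{finite,linorder} \<Rightarrow> nat) UNIV {1..CARD('l)}"
proof -
  have "range (level_no :: 'l \<Rightarrow> nat) \<subseteq> {1..CARD('l)}"
  proof -
    have "0 < level_no l \<and> level_no l \<le> CARD('l)" for l :: 'l
      unfolding level_no_def by (auto simp: card_gt_0_iff intro!: card_mono)
    then show ?thesis
      by (auto simp: Suc_le_eq)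
  qed
  moreover have "card (range (level_no :: 'l \<Rightarrow> nat)) = CARD('l)"
    using inj_level_no by (rule card_image)
  ultimately have "range (level_no :: 'l \<Rightarrow> nat) = {1..CARD('l)}"
    by (intro card_subset_eq) auto
  then show ?thesis
    using inj_level_no by (simp add: bij_betw_def)
qed

(* Different problems may have decision spaces R^d of different dimension d.  So that a family of
   problems has one type, the space R^d of a problem is a linear subspace decision_space of a
   common Euclidean space 'a (UNIV when the dimensions agree); only the values of the functions
   on decision_space matter. The constraint functions of level l are constr l 1, ...,
   constr l (num_constr l). *)

record ('a, 'l) problem =
  decision_space :: "'a set"
  feasible :: "'a set"
  objective :: "'a \<Rightarrow> real"
  num_constr :: "'l \<Rightarrow> nat"
  constr :: "'l \<Rightarrow> nat \<Rightarrow> 'a \<Rightarrow> real"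
  exponent :: nat

definition well_formed :: "('a::euclidean_space, 'l) problem \<Rightarrow> bool"
  where "well_formed P \<longleftrightarrow>
    subspace (decision_space P) \<and> feasible P \<subseteq> decision_space P \<and> exponent P \<in> {1, 2}"

definition violation :: "('a, 'l) problem \<Rightarrow> 'l \<Rightarrow> 'a \<Rightarrow> real"
  where "violation P l z = (\<Sum>j = 1..num_constr P l. (max 0 (constr P l j z)) ^ exponent P)"

primrec cascade :: "('a, 'l::{finite,linorder}) problem \<Rightarrow> nat \<Rightarrow> 'a set"
  where
    "cascade P 0 = feasible P"
  | "cascade P (Suc i) = {z \<in> cascade P i.
       violation P (level (Suc i)) z = (INF z'\<in>cascade P i. violation P (level (Suc i)) z')}"

(* The infimum is the minimum V_i* under existence_assms, which demands attainment. *)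
definition opt_violation :: "('a, 'l::{finite,linorder}) problem \<Rightarrow> nat \<Rightarrow> real"
  where "opt_violation P i = (INF z\<in>cascade P (i - 1). violation P (level i) z)"

definition lex_optimal :: "('a, 'l::{finite,linorder}) problem \<Rightarrow> 'a \<Rightarrow> bool"
  where "lex_optimal P = is_arg_min (objective P) (\<lambda>z. z \<in> cascade P CARD('l))"

definition lex_optimum :: "('a, 'l::{finite,linorder}) problem \<Rightarrow> 'a"
  where "lex_optimum P = (SOME z. lex_optimal P z)"

definition lex_image :: "('a, 'l::{finite,linorder}) problem \<Rightarrow> (real^'l::{finite,linorder}) \<times> real"
  where "lex_image P = ((\<chi> l. opt_violation P (level_no l)), objective P (lex_optimum P))"

definition weighted_sum :: "('a, 'l::finite) problem \<Rightarrow> real^'l \<Rightarrow> 'a \<Rightarrow> real"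
  where "weighted_sum P w z = objective P z + (\<Sum>l\<in>UNIV. w $ l * violation P l z)"

definition weighted_optimal :: "('a, 'l::finite) problem \<Rightarrow> real^'l \<Rightarrow> 'a \<Rightarrow> bool"
  where "weighted_optimal P w = is_arg_min (weighted_sum P w) (\<lambda>z. z \<in> feasible P)"

definition pos_orthant :: "(real^'l::finite) set"
  where "pos_orthant = {w. \<forall>l. 0 < w $ l}"

definition existence_assms :: "('a::euclidean_space, 'l::{finite,linorder}) problem \<Rightarrow> bool"
  where "existence_assms P \<longleftrightarrow>
    compact (feasible P) \<and>
    (\<forall>i\<in>{1..CARD('l)}. \<exists>z. is_arg_min (violation P (level i)) (\<lambda>z. z \<in> cascade P (i - 1)) z) \<and>
    (\<exists>z. lex_optimal P z) \<and>
    (\<forall>w\<in>pos_orthant. \<exists>z. weighted_optimal P w z)"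

definition uniqueness_assm :: "('a, 'l::{finite,linorder}) problem \<Rightarrow> bool"
  where "uniqueness_assm P \<longleftrightarrow> (\<exists>!z. lex_optimal P z)"

definition convexity_assms :: "('a::euclidean_space, 'l) problem \<Rightarrow> bool"
  where "convexity_assms P \<longleftrightarrow>
    convex (feasible P) \<and>
    (\<forall>l. \<forall>j\<in>{1..num_constr P l}. convex_on (decision_space P) (constr P l j)) \<and>
    convex_on (decision_space P) (objective P)"

definition upper_image :: "('a, 'l::finite) problem \<Rightarrow> ((real^'l) \<times> real) set"
  where "upper_image P =
    closure {(y, t). \<exists>z\<in>feasible P. (\<forall>l. violation P l z \<le> y $ l) \<and> objective P z \<le> t}"

definition normal_cone :: "'v::real_inner set \<Rightarrow> 'v \<Rightarrow> 'v set"
  where "normal_cone S p = {\<eta>. \<forall>q\<in>S. 0 \<le> \<eta> \<bullet> (q - p)}"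

definition equiv_region :: "('a, 'l::{finite,linorder}) problem \<Rightarrow> (real^'l::{finite,linorder}) set"
  where "equiv_region P =
    {w \<in> pos_orthant. (w, 1) \<in> normal_cone (upper_image P) (lex_image P)}"

definition robust_region :: "nat \<Rightarrow> (nat \<Rightarrow> ('a, 'l::{finite,linorder}) problem) \<Rightarrow> (real^'l::{finite,linorder}) set"
  where "robust_region K P = (\<Inter>q\<in>{1..K}. equiv_region (P q))"

(* A system C x \<le> d, E x = f is the pair of the lists of rows (c, d) of [C | d] and
   (e, f) of [E | f]. *)

type_synonym 'v lin_system = "('v \<times> real) list \<times> ('v \<times> real) list"

definition satisfies_ineqs :: "'v::real_inner lin_system \<Rightarrow> 'v \<Rightarrow> bool"
  where "satisfies_ineqs D x \<longleftrightarrow> (\<forall>(c, d)\<in>set (fst D). c \<bullet> x \<le> d)"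

definition satisfies_eqs :: "'v::real_inner lin_system \<Rightarrow> 'v \<Rightarrow> bool"
  where "satisfies_eqs D x \<longleftrightarrow> (\<forall>(e, f)\<in>set (snd D). e \<bullet> x = f)"

definition orthant_polyhedron :: "(real^'l::finite) lin_system \<Rightarrow> (real^'l) set"
  where "orthant_polyhedron D = {w \<in> pos_orthant. satisfies_ineqs D w \<and> satisfies_eqs D w}"

definition is_orthant_polyhedron :: "(real^'l::finite) set \<Rightarrow> bool"
  where "is_orthant_polyhedron S \<longleftrightarrow> (\<exists>D. S = orthant_polyhedron D)"

definition affine_fun_on :: "'a::euclidean_space set \<Rightarrow> ('a \<Rightarrow> real) \<Rightarrow> bool"
  where "affine_fun_on S f \<longleftrightarrow> (\<exists>a b. \<forall>z\<in>S. f z = a \<bullet> z + b)"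

definition piecewise_affine_on :: "'a::euclidean_space set \<Rightarrow> ('a \<Rightarrow> real) \<Rightarrow> bool"
  where "piecewise_affine_on S f \<longleftrightarrow>
    (\<exists>\<Q>. finite \<Q> \<and> \<Union>\<Q> = S \<and> (\<forall>Q\<in>\<Q>. polyhedron Q \<and> affine_fun_on Q f))"

(* Differentiability is relative to decision_space, i.e. that of a function on R^d. *)
definition polyhedral_data :: "('a::euclidean_space, 'l) problem \<Rightarrow> bool"
  where "polyhedral_data P \<longleftrightarrow>
    polyhedron (feasible P) \<and>
    (\<forall>l. \<forall>j\<in>{1..num_constr P l}. affine_fun_on (decision_space P) (constr P l j)) \<and>
    exponent P = 1 \<and>
    (convex_on (decision_space P) (objective P) \<and>
       piecewise_affine_on (decision_space P) (objective P)
     \<or> convex_on (decision_space P) (objective P) \<and>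
       (\<exists>U. open U \<and> feasible P \<subseteq> U \<and> objective P differentiable_on (U \<inter> decision_space P)))"

definition inscribed_ball ::
  "(real^'l::finite) lin_system \<Rightarrow> real^'l \<Rightarrow> real^'l \<Rightarrow> real^'l \<Rightarrow> real \<Rightarrow> bool"
  where "inscribed_ball D lo hi w r \<longleftrightarrow>
    0 \<le> r \<and> satisfies_eqs D w \<and> (\<forall>v\<in>cball w r. satisfies_ineqs D v \<and> v \<in> cbox lo hi)"

definition chebyshev_centre ::
  "(real^'l::finite) lin_system \<Rightarrow> real^'l \<Rightarrow> real^'l \<Rightarrow> real^'l \<Rightarrow> bool"
  where "chebyshev_centre D lo hi w \<longleftrightarrow>
    (\<exists>r. inscribed_ball D lo hi w r \<and> (\<forall>w' r'. inscribed_ball D lo hi w' r' \<longrightarrow> r' \<le> r))"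

(* Maximize lp_objective \<bullet> x subject to lp_system. *)
record 'v linear_program =
  lp_objective :: 'v
  lp_system :: "'v lin_system"

definition lp_optimal :: "'v::real_inner linear_program \<Rightarrow> 'v \<Rightarrow> bool"
  where "lp_optimal M = is_arg_max (\<lambda>x. lp_objective M \<bullet> x)
    (\<lambda>x. satisfies_ineqs (lp_system M) x \<and> satisfies_eqs (lp_system M) x)"

(* In the variables (w, r): maximize r subject to C_k w + |C_k| r \<le> d_k for every row k,
   w_l + r \<le> hi_l and - w_l + r \<le> - lo_l for every l, - r \<le> 0, and E w = f. *)
definition chebyshev_lp ::
  "(real^'l::{finite,linorder}) lin_system \<Rightarrow> real^'l::{finite,linorder} \<Rightarrow> real^'l::{finite,linorder}
    \<Rightarrow> ((real^'l::{finite,linorder}) \<times> real) linear_program"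
  where "chebyshev_lp D lo hi =
    \<lparr> lp_objective = (0, 1),
      lp_system =
        (map (\<lambda>(c, d). ((c, norm c), d)) (fst D)
         @ map (\<lambda>l. ((axis l 1, 1), hi $ l)) (sorted_list_of_set UNIV)
         @ map (\<lambda>l. ((- axis l 1, 1), - lo $ l)) (sorted_list_of_set UNIV)
         @ [((0, -1), 0)],
         map (\<lambda>(e, f). ((e, 0), f)) (snd D)) \<rparr>"

definition stacked_system :: "nat \<Rightarrow> (nat \<Rightarrow> 'v lin_system) \<Rightarrow> 'v lin_system"
  where "stacked_system K D =
    (concat (map (\<lambda>q. fst (D q)) [1..<Suc K]), concat (map (\<lambda>q. snd (D q)) [1..<Suc K]))"

end

theory Submission
  imports Defs
begin

text \<open>
  Write \<open>x\<close> for the lexicographic optimum of a problem. Since \<open>x\<close> lies in every set of the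
  cascade, its image under the violations and the objective is exactly the lexicographic image
  point. Hence a vector \<open>(w, 1)\<close> with \<open>w > 0\<close> lies in the normal cone at that point iff \<open>x\<close>
  minimizes the weighted sum at \<open>w\<close> over the feasible set (lemma \<open>equiv_region_eq\<close>): the upper
  image only enlarges the image of the feasible set in directions in which \<open>(w, 1)\<close> increases,
  and passing to the closure preserves a weak inequality. This gives the first claim, and it
  turns polyhedrality of an equivalence region into the question whether the condition
  "\<open>x\<close> minimizes \<open>J + (\<Sum>l. w l * V l)\<close> over \<open>Z\<close>" amounts to finitely many linear inequalities
  in \<open>w\<close>.

  For piecewise affine \<open>J\<close> and hinge sums \<open>V l\<close> it does: \<open>Z\<close> splits into finitely many polytopes,
  chosen independently of \<open>w\<close>, on each of which all these functions are affine
  (\<open>common_refinement\<close>). The weighted sum attains its minimum over each piece at one of finitely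
  many spanning points, so comparing \<open>x\<close> with these points suffices (\<open>finite_test_points\<close>,
  \<open>minimizing_weights_polyhedron\<close>). If \<open>J\<close> is convex and differentiable instead, the first-order
  condition allows \<open>J\<close> to be replaced by its derivative at \<open>x\<close>, which is linear
  (\<open>minimizer_iff_linearized\<close>); the base point \<open>x\<close> is the same for all \<open>w\<close>, which is what makes
  one replacement serve the whole region.

  Stacking the half-space descriptions describes the intersection. A ball lies in a half-space
  iff its centre satisfies the inequality tightened by radius times the norm of the row, so the
  feasible points of the linear program are exactly the inscribed balls
  (\<open>chebyshev_lp_feasible_iff\<close>); the box makes this feasible set compact, whence an optimum
  exists as soon as some ball, possibly of radius 0, is inscribed.
\<close>

section \<open>The equivalence region as a set of weights\<close>

lemma level_level_no [simp]: "level (level_no l) = l"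
  by (simp add: level_def inj_level_no)

lemma level_no_bounds: "1 \<le> level_no (l::'l::{finite,linorder})" "level_no l \<le> CARD('l)"
  using bij_betwE[OF bij_level_no] by auto

lemma cascade_antimono: "m \<le> n \<Longrightarrow> cascade P n \<subseteq> cascade P m"
  by (induction rule: dec_induct) auto

lemma lex_optimal_lex_optimum: "existence_assms P \<Longrightarrow> lex_optimal P (lex_optimum P)"
  unfolding existence_assms_def lex_optimum_def by (meson someI_ex)

lemma lex_optimum_in_cascade:
  fixes P :: "('a::euclidean_space, 'l::{finite,linorder}) problem"
  assumes "existence_assms P" "i \<le> CARD('l)"
  shows "lex_optimum P \<in> cascade P i"
  using lex_optimal_lex_optimum[OF assms(1)] cascade_antimono[OF assms(2), of P]
  by (auto simp: lex_optimal_def is_arg_min_def)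

lemma lex_optimum_feasible: "existence_assms P \<Longrightarrow> lex_optimum P \<in> feasible P"
  using lex_optimum_in_cascade[of P 0] by simp

text \<open>The optimal violation of a level is attained by every member of the cascade set of that
  level, in particular by the lexicographic optimum.\<close>

lemma lex_image_eq:
  assumes "existence_assms P"
  shows "lex_image P = ((\<chi> l. violation P l (lex_optimum P)), objective P (lex_optimum P))"
proof -
  have "opt_violation P (level_no l) = violation P l (lex_optimum P)" for l
  proof -
    obtain i where i: "level_no l = Suc i"
      using level_no_bounds(1)[of l] by (cases "level_no l") auto
    have "lex_optimum P \<in> cascade P (Suc i)"
      using lex_optimum_in_cascade[OF assms level_no_bounds(2)[of l]] by (simp only: i)
    moreover have "level (Suc i) = l"
      by (simp flip: i)
    ultimately show ?thesis
      by (simp add: opt_violation_def i)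
  qed
  then show ?thesis
    by (simp add: lex_image_def)
qed

text \<open>For a point lying componentwise above the image of a feasible point, the pairing of \<open>(w, 1)\<close> with its
  offset from the lexicographic image bounds from above the difference of the weighted sums at that
  feasible point and at the lexicographic optimum, with equality at the image itself.\<close>

lemma equiv_region_eq:
  fixes P :: "('a::euclidean_space, 'l::{finite,linorder}) problem"
  assumes "existence_assms P"
  shows "equiv_region P =
    {w \<in> pos_orthant. \<forall>z\<in>feasible P. weighted_sum P w (lex_optimum P) \<le> weighted_sum P w z}"
proof -
  define x where "x = lex_optimum P"
  define A where "A = {(y, t). \<exists>z\<in>feasible P. (\<forall>l. violation P l z \<le> y $ l) \<and> objective P z \<le> t}"
  have inner: "(w, 1) \<bullet> ((y, t) - lex_image P) =
      (t + (\<Sum>l\<in>UNIV. w $ l * y $ l)) - weighted_sum P w x" for w y t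
    unfolding lex_image_eq[OF assms] x_def[symmetric] weighted_sum_def
    by (simp add: inner_vec_def sum_subtractf right_diff_distrib)
  have "(w, 1) \<in> normal_cone (upper_image P) (lex_image P) \<longleftrightarrow>
      (\<forall>z\<in>feasible P. weighted_sum P w x \<le> weighted_sum P w z)" (is "?N \<longleftrightarrow> ?M")
    if w: "w \<in> pos_orthant" for w
  proof
    assume N: ?N
    show ?M
    proof
      fix z assume z: "z \<in> feasible P"
      have "((\<chi> l. violation P l z), objective P z) \<in> upper_image P"
        unfolding upper_image_def using z by (intro subsetD[OF closure_subset]) auto
      with N have "0 \<le> (w, 1) \<bullet> (((\<chi> l. violation P l z), objective P z) - lex_image P)"
        unfolding normal_cone_def by blast
      then show "weighted_sum P w x \<le> weighted_sum P w z"
        unfolding inner by (simp add: weighted_sum_def)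
    qed
  next
    assume M: ?M
    have "A \<subseteq> {q. 0 \<le> (w, 1) \<bullet> (q - lex_image P)}"
    proof
      fix q assume "q \<in> A"
      then obtain y t z where q: "q = (y, t)" and z: "z \<in> feasible P"
        "\<And>l. violation P l z \<le> y $ l" "objective P z \<le> t"
        by (auto simp: A_def)
      have "weighted_sum P w z \<le> t + (\<Sum>l\<in>UNIV. w $ l * y $ l)"
        unfolding weighted_sum_def using z w
        by (intro add_mono sum_mono mult_left_mono) (auto simp: pos_orthant_def less_imp_le)
      with M z(1) show "q \<in> {q. 0 \<le> (w, 1) \<bullet> (q - lex_image P)}"
        by (simp only: q mem_Collect_eq inner) fastforce
    qed
    moreover have "closed {q. 0 \<le> (w, 1::real) \<bullet> (q - lex_image P)}"
      by (intro closed_Collect_le continuous_intros)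
    ultimately have "closure A \<subseteq> {q. 0 \<le> (w, 1) \<bullet> (q - lex_image P)}"
      by (rule closure_minimal)
    then show ?N
      unfolding normal_cone_def upper_image_def A_def by blast
  qed
  then show ?thesis
    unfolding equiv_region_def x_def by blast
qed

section \<open>Piecewise affine functions on polyhedra\<close>

lemma affine_fun_on_subset: "affine_fun_on S f \<Longrightarrow> T \<subseteq> S \<Longrightarrow> affine_fun_on T f"
  unfolding affine_fun_on_def by blast

lemma affine_fun_on_const: "affine_fun_on S (\<lambda>z. c)"
  unfolding affine_fun_on_def by (intro exI[of _ 0] exI[of _ c]) auto

lemma affine_fun_on_add:
  assumes "affine_fun_on S f" "affine_fun_on S g"
  shows "affine_fun_on S (\<lambda>z. f z + g z)"
proof -
  obtain a b a' b' where "\<forall>z\<in>S. f z = a \<bullet> z + b" "\<forall>z\<in>S. g z = a' \<bullet> z + b'"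
    using assms unfolding affine_fun_on_def by blast
  then have "\<forall>z\<in>S. f z + g z = (a + a') \<bullet> z + (b + b')"
    by (simp add: inner_add_left)
  then show ?thesis
    unfolding affine_fun_on_def by blast
qed

lemma affine_fun_on_cmult:
  assumes "affine_fun_on S f"
  shows "affine_fun_on S (\<lambda>z. c * f z)"
proof -
  obtain a b where "\<forall>z\<in>S. f z = a \<bullet> z + b"
    using assms unfolding affine_fun_on_def by blast
  then have "\<forall>z\<in>S. c * f z = (c *\<^sub>R a) \<bullet> z + c * b"
    by (simp add: distrib_left)
  then show ?thesis
    unfolding affine_fun_on_def by blast
qed

lemma affine_fun_on_sum:
  assumes "\<And>i. i \<in> I \<Longrightarrow> affine_fun_on S (f i)"
  shows "affine_fun_on S (\<lambda>z. \<Sum>i\<in>I. f i z)"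
  using assms
  by (induction I rule: infinite_finite_induct)
    (simp_all add: affine_fun_on_const affine_fun_on_add)

lemma piecewise_affine_on_subset:
  assumes "piecewise_affine_on S f" "polyhedron Z" "Z \<subseteq> S"
  shows "piecewise_affine_on Z f"
proof -
  obtain \<Q> where \<Q>: "finite \<Q>" "\<Union>\<Q> = S" "\<forall>Q\<in>\<Q>. polyhedron Q \<and> affine_fun_on Q f"
    using assms(1) unfolding piecewise_affine_on_def by blast
  show ?thesis
    unfolding piecewise_affine_on_def
  proof (intro exI[of _ "(\<lambda>Q. Z \<inter> Q) ` \<Q>"] conjI)
    show "\<Union> ((\<lambda>Q. Z \<inter> Q) ` \<Q>) = Z"
      using \<Q>(2) assms(3) by blast
  qed (use \<Q> assms(2) in \<open>auto intro: affine_fun_on_subset[OF _ Int_lower2]\<close>)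
qed

text \<open>Intersecting the pieces of finitely many functions gives pieces that serve all of them, and
  therefore all of their linear combinations at once.\<close>

lemma common_refinement:
  assumes "finite G" "polyhedron S" "\<And>g. g \<in> G \<Longrightarrow> piecewise_affine_on S g"
  shows "\<exists>\<Q>. finite \<Q> \<and> \<Union>\<Q> = S \<and> (\<forall>Q\<in>\<Q>. polyhedron Q \<and> (\<forall>g\<in>G. affine_fun_on Q g))"
  using assms(1,3)
proof (induction G rule: finite_induct)
  case empty
  show ?case
    by (intro exI[of _ "{S}"]) (simp add: assms(2))
next
  case (insert g G)
  obtain \<Q> where \<Q>: "finite \<Q>" "\<Union>\<Q> = S"
    "\<forall>Q\<in>\<Q>. polyhedron Q \<and> (\<forall>g\<in>G. affine_fun_on Q g)"
    using insert by blast
  obtain \<R> where \<R>: "finite \<R>" "\<Union>\<R> = S" "\<forall>R\<in>\<R>. polyhedron R \<and> affine_fun_on R g"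
    using insert.prems unfolding piecewise_affine_on_def by blast
  show ?case
  proof (intro exI[of _ "(\<lambda>(Q, R). Q \<inter> R) ` (\<Q> \<times> \<R>)"] conjI ballI)
    show "\<Union> ((\<lambda>(Q, R). Q \<inter> R) ` (\<Q> \<times> \<R>)) = S"
      using \<Q>(2) \<R>(2) by fastforce
  qed (use \<Q> \<R> in \<open>auto intro: affine_fun_on_subset[OF _ Int_lower1]
      affine_fun_on_subset[OF _ Int_lower2]\<close>)
qed

lemma piecewise_affine_on_sum:
  assumes "finite I" "polyhedron S" "\<And>i. i \<in> I \<Longrightarrow> piecewise_affine_on S (f i)"
  shows "piecewise_affine_on S (\<lambda>z. \<Sum>i\<in>I. f i z)"
proof -
  obtain \<Q> where "finite \<Q>" "\<Union>\<Q> = S"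
    "\<forall>Q\<in>\<Q>. polyhedron Q \<and> (\<forall>g\<in>f ` I. affine_fun_on Q g)"
    using common_refinement[of "f ` I" S] assms by blast
  then show ?thesis
    unfolding piecewise_affine_on_def by (intro exI[of _ \<Q>] conjI ballI affine_fun_on_sum) auto
qed

lemma piecewise_affine_on_hinge:
  assumes "polyhedron S" "affine_fun_on S g"
  shows "piecewise_affine_on S (\<lambda>z. max 0 (g z))"
proof -
  obtain a b where g: "\<forall>z\<in>S. g z = a \<bullet> z + b"
    using assms(2) unfolding affine_fun_on_def by blast
  let ?Q = "S \<inter> {z. a \<bullet> z \<le> - b}" and ?R = "S \<inter> {z. a \<bullet> z \<ge> - b}"
  have "affine_fun_on ?Q (\<lambda>z. max 0 (g z))"
    using g unfolding affine_fun_on_def by (intro exI[of _ 0]) auto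
  moreover have "affine_fun_on ?R (\<lambda>z. max 0 (g z))"
    using g unfolding affine_fun_on_def by (intro exI[of _ a] exI[of _ b]) auto
  moreover have "\<Union> {?Q, ?R} = S"
    by auto
  ultimately show ?thesis
    unfolding piecewise_affine_on_def using assms(1)
    by (intro exI[of _ "{?Q, ?R}"])
      (auto intro!: polyhedron_Int polyhedron_halfspace_le polyhedron_halfspace_ge)
qed

text \<open>On each piece of a common refinement the weighted sum is affine, and an affine function on
  the convex hull of a finite set is bounded below by one of its values on that set. The pieces,
  and with them the test points, do not depend on the weights.\<close>

lemma finite_test_points:
  fixes f :: "'a::euclidean_space \<Rightarrow> real" and V :: "'l::finite \<Rightarrow> 'a \<Rightarrow> real"
  assumes "polytope Z" "piecewise_affine_on Z f" "\<And>l. piecewise_affine_on Z (V l)"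
  shows "\<exists>T. finite T \<and> T \<subseteq> Z \<and> (\<forall>w::real^'l. \<forall>z\<in>Z. \<exists>t\<in>T.
    f t + (\<Sum>l\<in>UNIV. w $ l * V l t) \<le> f z + (\<Sum>l\<in>UNIV. w $ l * V l z))"
proof -
  have poly: "polyhedron Z" and bdd: "bounded Z"
    using assms(1) by (auto simp: polytope_eq_bounded_polyhedron)
  obtain \<Q> where \<Q>: "finite \<Q>" "\<Union>\<Q> = Z"
    "\<forall>Q\<in>\<Q>. polyhedron Q \<and> (\<forall>g\<in>insert f (range V). affine_fun_on Q g)"
  proof -
    have "finite (insert f (range V))"
      "\<And>g. g \<in> insert f (range V) \<Longrightarrow> piecewise_affine_on Z g"
      using assms(2,3) by auto
    with common_refinement[OF _ poly] that show ?thesis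
      by blast
  qed
  have "\<forall>Q\<in>\<Q>. \<exists>T. finite T \<and> convex hull T = Q"
  proof
    fix Q assume Q: "Q \<in> \<Q>"
    then have "bounded Q"
      using \<Q>(2) bdd by (auto intro: bounded_subset)
    with Q have "polytope Q"
      using \<Q>(3) by (auto simp: polytope_eq_bounded_polyhedron)
    then show "\<exists>T. finite T \<and> convex hull T = Q"
      by (auto simp: polytope_def)
  qed
  then obtain T where T: "\<And>Q. Q \<in> \<Q> \<Longrightarrow> finite (T Q)" "\<And>Q. Q \<in> \<Q> \<Longrightarrow> convex hull (T Q) = Q"
    by metis
  have *: "\<exists>t\<in>T Q. h t \<le> h z" if Q: "Q \<in> \<Q>" "z \<in> Q" and h: "affine_fun_on Q h" for Q z h
  proof (rule ccontr)
    assume "\<not> ?thesis"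
    then have less: "\<forall>t\<in>T Q. h z < h t"
      by auto
    obtain a b where ab: "\<forall>z\<in>Q. h z = a \<bullet> z + b"
      using h unfolding affine_fun_on_def by blast
    have "T Q \<subseteq> Q"
      using hull_subset[of "T Q" convex] unfolding T(2)[OF Q(1)] .
    then have "T Q \<subseteq> {t. a \<bullet> t > a \<bullet> z}"
      using less ab Q(2) by (auto dest!: subsetD)
    then have "convex hull T Q \<subseteq> {t. a \<bullet> t > a \<bullet> z}"
      by (intro hull_minimal convex_halfspace_gt)
    then show False
      using Q(2) unfolding T(2)[OF Q(1)] by blast
  qed
  have "affine_fun_on Q (\<lambda>z. f z + (\<Sum>l\<in>UNIV. w $ l * V l z))"
    if "Q \<in> \<Q>" for Q and w :: "real^'l"
    using that \<Q>(3) by (intro affine_fun_on_add affine_fun_on_sum affine_fun_on_cmult) auto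
  note test = *[OF _ _ this]
  have sub: "T Q \<subseteq> Z" if "Q \<in> \<Q>" for Q
    using hull_subset[of "T Q" convex] \<Q>(2) that unfolding T(2)[OF that] by blast
  show ?thesis
  proof (intro exI[of _ "\<Union>Q\<in>\<Q>. T Q"] conjI allI ballI)
    fix w :: "real^'l" and z assume "z \<in> Z"
    then obtain Q where Q: "Q \<in> \<Q>" "z \<in> Q"
      using \<Q>(2) by blast
    show "\<exists>t\<in>\<Union>Q\<in>\<Q>. T Q.
        f t + (\<Sum>l\<in>UNIV. w $ l * V l t) \<le> f z + (\<Sum>l\<in>UNIV. w $ l * V l z)"
      using test[OF Q Q(1), of w] UN_I[OF Q(1)] by (meson bexE bexI)
  next
    show "finite (\<Union>Q\<in>\<Q>. T Q)"
      using \<Q>(1) T(1) by (rule finite_UN_I)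
    show "(\<Union>Q\<in>\<Q>. T Q) \<subseteq> Z"
      using sub by (rule UN_least)
  qed
qed

text \<open>Comparison of \<open>x\<close> with a single test point is linear in the weights.\<close>

lemma minimizing_weights_polyhedron:
  fixes f :: "'a::euclidean_space \<Rightarrow> real" and V :: "'l::finite \<Rightarrow> 'a \<Rightarrow> real"
  assumes "polytope Z" "piecewise_affine_on Z f" "\<And>l. piecewise_affine_on Z (V l)"
  shows "is_orthant_polyhedron {w \<in> pos_orthant. \<forall>z\<in>Z.
    f x + (\<Sum>l\<in>UNIV. w $ l * V l x) \<le> f z + (\<Sum>l\<in>UNIV. w $ l * V l z)}"
    (is "is_orthant_polyhedron {w \<in> _. \<forall>z\<in>Z. ?h w x \<le> ?h w z}")
proof -
  obtain T where T: "finite T" "T \<subseteq> Z" "\<forall>w. \<forall>z\<in>Z. \<exists>t\<in>T. ?h w t \<le> ?h w z"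
    using finite_test_points[of Z f V, OF assms] by (elim exE conjE) (rule that)
  obtain ts where ts: "set ts = T"
    using finite_list[OF T(1)] by blast
  define D where "D = (map (\<lambda>t. ((\<chi> l. V l x - V l t) :: real^'l, f t - f x)) ts,
    [] :: ((real^'l) \<times> real) list)"
  have row: "(\<chi> l. V l x - V l t) \<bullet> w \<le> f t - f x \<longleftrightarrow> ?h w x \<le> ?h w t" for w t
  proof -
    have "(\<chi> l. V l x - V l t) \<bullet> w = (\<Sum>l\<in>UNIV. w $ l * V l x - w $ l * V l t)"
      unfolding inner_vec_def by (intro sum.cong) (auto simp: algebra_simps)
    then show ?thesis
      unfolding sum_subtractf by linarith
  qed
  have "(\<forall>z\<in>Z. ?h w x \<le> ?h w z) \<longleftrightarrow> (\<forall>t\<in>T. ?h w x \<le> ?h w t)" for w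
  proof (intro iffI ballI)
    fix z assume min: "\<forall>t\<in>T. ?h w x \<le> ?h w t" and "z \<in> Z"
    then obtain t where "t \<in> T" "?h w t \<le> ?h w z"
      using T(3) by (elim allE[of _ w] ballE[of _ _ z]) auto
    with min show "?h w x \<le> ?h w z"
      by (blast intro: order_trans)
  qed (use T(2) in blast)
  moreover have "satisfies_ineqs D w \<longleftrightarrow> (\<forall>t\<in>T. ?h w x \<le> ?h w t)" "satisfies_eqs D w" for w
    unfolding satisfies_ineqs_def satisfies_eqs_def D_def by (simp_all add: ts row)
  ultimately have "{w \<in> pos_orthant. \<forall>z\<in>Z. ?h w x \<le> ?h w z} = orthant_polyhedron D"
    by (simp only: orthant_polyhedron_def simp_thms)
  then show ?thesis
    unfolding is_orthant_polyhedron_def by blast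
qed

section \<open>Linearization of a differentiable convex objective\<close>

lemma difference_quotient_along_segment:
  fixes f :: "'a::real_normed_vector \<Rightarrow> real"
  assumes "(f has_derivative f') (at x within Z)" "convex Z" "x \<in> Z" "z \<in> Z"
  shows "((\<lambda>t. (f (x + t *\<^sub>R (z - x)) - f x) / t) \<longlongrightarrow> f' (z - x)) (at_right 0)"
proof -
  let ?p = "\<lambda>t. x + t *\<^sub>R (z - x)"
  have "?p ` {0..1} \<subseteq> Z"
    using assms(2-4) by (auto simp: algebra_simps convex_alt)
  then have "(f has_derivative f') (at (?p 0) within ?p ` {0..1})"
    using assms(1) by (auto intro: has_derivative_subset)
  moreover have "(?p has_derivative (\<lambda>t. t *\<^sub>R (z - x))) (at 0 within {0..1})"
    by (auto intro!: derivative_eq_intros)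
  ultimately have "(f \<circ> ?p has_derivative f' \<circ> (\<lambda>t. t *\<^sub>R (z - x))) (at 0 within {0..1})"
    by (rule diff_chain_within[rotated])
  moreover have "f' \<circ> (\<lambda>t. t *\<^sub>R (z - x)) = (*) (f' (z - x))"
    using has_derivative_linear[OF assms(1)] by (auto simp: linear_scale)
  ultimately have "(f \<circ> ?p has_field_derivative f' (z - x)) (at 0 within {0..1})"
    by (simp add: has_field_derivative_def)
  then show ?thesis
    by (simp add: has_field_derivative_iff at_within_Icc_at_right)
qed

text \<open>Along the segment from \<open>x\<close> to \<open>z\<close> the difference quotients of \<open>f\<close> tend to \<open>f' (z - x)\<close>.
  Convexity of \<open>f\<close> bounds them above by \<open>f z - f x\<close>; minimality of \<open>f + g\<close> at \<open>x\<close> and convexity of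
  \<open>g\<close> bound them below by \<open>g x - g z\<close>. Each bound gives one direction in the limit.\<close>

lemma minimizer_iff_linearized:
  fixes f g :: "'a::real_normed_vector \<Rightarrow> real"
  assumes Z: "convex Z" "x \<in> Z" and f: "convex_on Z f" and g: "convex_on Z g"
    and f': "(f has_derivative f') (at x within Z)"
  shows "(\<forall>z\<in>Z. f x + g x \<le> f z + g z) \<longleftrightarrow> (\<forall>z\<in>Z. f' x + g x \<le> f' z + g z)"
proof -
  have chord: "h (x + t *\<^sub>R (z - x)) - h x \<le> t * (h z - h x)"
    if "convex_on Z h" "z \<in> Z" "0 < t" "t < 1" for h :: "'a \<Rightarrow> real" and z t
  proof -
    have "h ((1 - t) *\<^sub>R x + t *\<^sub>R z) \<le> (1 - t) * h x + t * h z"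
      using that Z by (intro convex_onD) auto
    then show ?thesis
      by (simp add: algebra_simps)
  qed
  have small: "\<forall>\<^sub>F t in at_right (0::real). 0 < t \<and> t < 1"
    using eventually_at_right_real[of 0 "1::real"] by simp
  have lin: "f' (z - x) = f' z - f' x" for z
    using has_derivative_linear[OF f'] by (rule linear_diff)
  show ?thesis
  proof (intro iffI ballI)
    fix z assume z: "z \<in> Z" and min: "\<forall>z\<in>Z. f x + g x \<le> f z + g z"
    have "\<forall>\<^sub>F t in at_right 0. g x - g z \<le> (f (x + t *\<^sub>R (z - x)) - f x) / t"
      using small
    proof eventually_elim
      case (elim t)
      have "(1 - t) *\<^sub>R x + t *\<^sub>R z \<in> Z"
        using Z z elim by (auto simp: convex_alt)
      then have "x + t *\<^sub>R (z - x) \<in> Z"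
        by (simp add: algebra_simps)
      then have "t * (g x - g z) \<le> f (x + t *\<^sub>R (z - x)) - f x"
        using min chord[OF g z, of t] elim by (force simp: algebra_simps)
      then show ?case
        using elim by (simp add: pos_le_divide_eq mult.commute)
    qed
    then have "g x - g z \<le> f' (z - x)"
      by (rule tendsto_lowerbound[OF difference_quotient_along_segment[OF f' Z z]]) simp
    then show "f' x + g x \<le> f' z + g z"
      by (simp add: lin)
  next
    fix z assume z: "z \<in> Z" and min: "\<forall>z\<in>Z. f' x + g x \<le> f' z + g z"
    have "\<forall>\<^sub>F t in at_right 0. (f (x + t *\<^sub>R (z - x)) - f x) / t \<le> f z - f x"
      using small
    proof eventually_elim
      case (elim t)
      then show ?case
        using chord[OF f z, of t] by (simp add: pos_divide_le_eq mult.commute)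
    qed
    then have "f' (z - x) \<le> f z - f x"
      by (rule tendsto_upperbound[OF difference_quotient_along_segment[OF f' Z z]]) simp
    then show "f x + g x \<le> f z + g z"
      using min z by (force simp: lin)
  qed
qed

lemma convex_on_hinge:
  fixes g :: "'a::real_vector \<Rightarrow> real"
  assumes "convex_on S g"
  shows "convex_on S (\<lambda>z. max 0 (g z))"
proof (rule convex_onI)
  fix t x y assume t: "0 < t" "t < (1::real)" and xy: "x \<in> S" "y \<in> S"
  have "g ((1 - t) *\<^sub>R x + t *\<^sub>R y) \<le> (1 - t) * g x + t * g y"
    using assms t xy by (intro convex_onD) auto
  also have "\<dots> \<le> (1 - t) * max 0 (g x) + t * max 0 (g y)"
    using t by (intro add_mono mult_left_mono) auto
  finally show "max 0 (g ((1 - t) *\<^sub>R x + t *\<^sub>R y)) \<le> (1 - t) * max 0 (g x) + t * max 0 (g y)"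
    using t by simp
qed (use assms in \<open>auto dest: convex_on_imp_convex\<close>)

lemma convex_on_sum_functions:
  assumes "convex S" "\<And>i. i \<in> I \<Longrightarrow> convex_on S (f i)"
  shows "convex_on S (\<lambda>z. \<Sum>i\<in>I. f i z)"
  using assms(2)
  by (induction I rule: infinite_finite_induct)
    (simp_all add: assms(1) convex_on_const convex_on_add)

lemma equiv_region_polyhedron:
  fixes P :: "('a::euclidean_space, 'l::{finite,linorder}) problem"
  assumes wf: "well_formed P" and ex: "existence_assms P" and conv: "convexity_assms P"
    and data: "polyhedral_data P"
  shows "is_orthant_polyhedron (equiv_region P)"
proof -
  define Z W where "Z = feasible P" and "W = decision_space P"
  define x where "x = lex_optimum P"
  have ZW: "Z \<subseteq> W" and Z: "compact Z" "convex Z" "polyhedron Z" and x: "x \<in> Z"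
    using assms lex_optimum_feasible[OF ex]
    by (auto simp: Z_def W_def x_def well_formed_def existence_assms_def convexity_assms_def
        polyhedral_data_def)
  have pt: "polytope Z"
    using Z by (simp add: polytope_eq_bounded_polyhedron compact_imp_bounded)
  have V: "violation P l = (\<lambda>z. \<Sum>j = 1..num_constr P l. max 0 (constr P l j z))" for l
    using data by (auto simp: violation_def polyhedral_data_def)
  have pwV: "piecewise_affine_on Z (violation P l)" for l
    unfolding V
  proof (intro piecewise_affine_on_sum piecewise_affine_on_hinge Z(3))
    fix j assume "j \<in> {1..num_constr P l}"
    with data show "affine_fun_on Z (constr P l j)"
      unfolding polyhedral_data_def using affine_fun_on_subset ZW unfolding W_def by blast
  qed simp
  have convV: "convex_on Z (violation P l)" for l
    unfolding V
  proof (intro convex_on_sum_functions convex_on_hinge Z(2))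
    fix j assume "j \<in> {1..num_constr P l}"
    then show "convex_on Z (constr P l j)"
      using conv convex_on_subset[OF _ ZW Z(2)] unfolding convexity_assms_def W_def by blast
  qed
  have convJ: "convex_on Z (objective P)"
    using conv ZW Z(2) by (auto simp: convexity_assms_def W_def intro: convex_on_subset)
  have region: "equiv_region P = {w \<in> pos_orthant. \<forall>z\<in>Z.
      objective P x + (\<Sum>l\<in>UNIV. w $ l * violation P l x)
      \<le> objective P z + (\<Sum>l\<in>UNIV. w $ l * violation P l z)}"
    unfolding equiv_region_eq[OF ex] weighted_sum_def Z_def x_def ..
  consider (pwa) "piecewise_affine_on W (objective P)"
    | (diff) U where "open U" "Z \<subseteq> U" "objective P differentiable_on (U \<inter> W)"
    using data by (auto simp: polyhedral_data_def Z_def W_def)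
  then show ?thesis
  proof cases
    case pwa
    then have "piecewise_affine_on Z (objective P)"
      using Z(3) ZW by (rule piecewise_affine_on_subset)
    then show ?thesis
      unfolding region by (intro minimizing_weights_polyhedron pt pwV)
  next
    case diff
    then obtain f' where f': "(objective P has_derivative f') (at x within Z)"
      using x ZW unfolding differentiable_on_def differentiable_def
      by (meson IntI has_derivative_subset le_inf_iff subsetD)
    have "f' z = adjoint f' 1 \<bullet> z + 0" for z
      using adjoint_works[OF has_derivative_linear[OF f'], of z 1] by (simp add: inner_commute)
    then have "affine_fun_on Z f'"
      unfolding affine_fun_on_def by blast
    then have "piecewise_affine_on Z f'"
      unfolding piecewise_affine_on_def using Z(3) by (intro exI[of _ "{Z}"]) auto
    moreover have "equiv_region P = {w \<in> pos_orthant. \<forall>z\<in>Z.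
      f' x + (\<Sum>l\<in>UNIV. w $ l * violation P l x)
      \<le> f' z + (\<Sum>l\<in>UNIV. w $ l * violation P l z)}"
    proof -
      have "convex_on Z (\<lambda>z. \<Sum>l\<in>UNIV. w $ l * violation P l z)" if "w \<in> pos_orthant" for w
        using that convV Z(2)
        by (intro convex_on_sum_functions convex_on_cmul) (auto simp: pos_orthant_def less_imp_le)
      then show ?thesis
        unfolding region
        using minimizer_iff_linearized[OF Z(2) x convJ _ f'] by blast
    qed
    ultimately show ?thesis
      by (auto intro: minimizing_weights_polyhedron pt pwV)
  qed
qed

section \<open>The robust region and its Chebyshev centre\<close>

lemma stacked_orthant_polyhedron:
  assumes "1 \<le> K"
  shows "(\<Inter>q\<in>{1..K}. orthant_polyhedron (D q)) = orthant_polyhedron (stacked_system K D)"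
proof -
  have "satisfies_ineqs (stacked_system K D) w \<longleftrightarrow> (\<forall>q\<in>{1..K}. satisfies_ineqs (D q) w)"
    "satisfies_eqs (stacked_system K D) w \<longleftrightarrow> (\<forall>q\<in>{1..K}. satisfies_eqs (D q) w)" for w
    unfolding satisfies_ineqs_def satisfies_eqs_def stacked_system_def
    by (force simp: less_Suc_eq_le)+
  then show ?thesis
    using assms by (auto simp: orthant_polyhedron_def)
qed

text \<open>The extreme point of the ball in the direction of \<open>c\<close> decides; for \<open>c = 0\<close> this point is
  the centre, because \<open>sgn 0 = 0\<close>.\<close>

lemma ball_in_halfspace_iff:
  fixes c :: "'a::real_inner"
  assumes "0 \<le> r"
  shows "(\<forall>v\<in>cball w r. c \<bullet> v \<le> d) \<longleftrightarrow> c \<bullet> w + norm c * r \<le> d"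
proof
  assume L: "\<forall>v\<in>cball w r. c \<bullet> v \<le> d"
  let ?v = "w + r *\<^sub>R sgn c"
  have "?v \<in> cball w r"
    using assms by (simp add: dist_norm norm_sgn)
  with L have "c \<bullet> ?v \<le> d"
    by blast
  moreover have "c \<bullet> sgn c = norm c"
    by (cases "c = 0") (simp_all add: sgn_div_norm dot_square_norm power2_eq_square)
  ultimately show "c \<bullet> w + norm c * r \<le> d"
    by (simp add: inner_add_right mult.commute)
next
  assume R: "c \<bullet> w + norm c * r \<le> d"
  show "\<forall>v\<in>cball w r. c \<bullet> v \<le> d"
  proof
    fix v assume "v \<in> cball w r"
    then have "norm (v - w) \<le> r"
      by (simp add: dist_norm norm_minus_commute)
    then have "c \<bullet> (v - w) \<le> norm c * r"
      by (meson mult_left_mono norm_cauchy_schwarz norm_ge_zero order_trans)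
    then show "c \<bullet> v \<le> d"
      using R by (simp add: inner_diff_right)
  qed
qed

lemma chebyshev_lp_feasible_iff:
  "satisfies_ineqs (lp_system (chebyshev_lp D lo hi)) (w, r) \<and>
   satisfies_eqs (lp_system (chebyshev_lp D lo hi)) (w, r) \<longleftrightarrow> inscribed_ball D lo hi w r"
proof -
  have lp_ineqs: "satisfies_ineqs (lp_system (chebyshev_lp D lo hi)) (w, r) \<longleftrightarrow> 0 \<le> r \<and>
      (\<forall>(c, d)\<in>set (fst D). c \<bullet> w + norm c * r \<le> d) \<and>
      (\<forall>l. w $ l + r \<le> hi $ l) \<and> (\<forall>l. - w $ l + r \<le> - lo $ l)"
    by (simp add: satisfies_ineqs_def chebyshev_lp_def ball_Un inner_axis' split_beta conj_assoc)
  have lp_eqs: "satisfies_eqs (lp_system (chebyshev_lp D lo hi)) (w, r) \<longleftrightarrow> satisfies_eqs D w"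
    by (simp add: satisfies_eqs_def chebyshev_lp_def split_beta)
  have "(\<forall>v\<in>cball w r. satisfies_ineqs D v) \<longleftrightarrow>
      (\<forall>(c, d)\<in>set (fst D). c \<bullet> w + norm c * r \<le> d)"
    and "(\<forall>v\<in>cball w r. v \<in> cbox lo hi) \<longleftrightarrow>
      (\<forall>l. w $ l + r \<le> hi $ l) \<and> (\<forall>l. - w $ l + r \<le> - lo $ l)" if "0 \<le> r"
  proof -
    show "(\<forall>v\<in>cball w r. satisfies_ineqs D v) \<longleftrightarrow>
      (\<forall>(c, d)\<in>set (fst D). c \<bullet> w + norm c * r \<le> d)"
      unfolding ball_in_halfspace_iff[OF that, symmetric] satisfies_ineqs_def by blast
    \<comment> \<open>The faces of the box are half-spaces with unit normals, so each is tightened by \<open>r\<close>.\<close>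
    have "(\<forall>v\<in>cball w r. v \<in> cbox lo hi) \<longleftrightarrow>
      (\<forall>l. \<forall>v\<in>cball w r. axis l 1 \<bullet> v \<le> hi $ l) \<and>
      (\<forall>l. \<forall>v\<in>cball w r. (- axis l 1) \<bullet> v \<le> - lo $ l)"
      by (simp add: mem_box_cart inner_axis') blast
    then show "(\<forall>v\<in>cball w r. v \<in> cbox lo hi) \<longleftrightarrow>
      (\<forall>l. w $ l + r \<le> hi $ l) \<and> (\<forall>l. - w $ l + r \<le> - lo $ l)"
      unfolding ball_in_halfspace_iff[OF that] by (simp add: inner_axis')
  qed
  then show ?thesis
    unfolding lp_ineqs lp_eqs inscribed_ball_def by blast
qed

lemma chebyshev_centre_iff_lp:
  "chebyshev_centre D lo hi w \<longleftrightarrow> (\<exists>r. lp_optimal (chebyshev_lp D lo hi) (w, r))"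
proof -
  have "lp_optimal (chebyshev_lp D lo hi) (w, r) \<longleftrightarrow>
      inscribed_ball D lo hi w r \<and> (\<forall>w' r'. inscribed_ball D lo hi w' r' \<longrightarrow> r' \<le> r)" for r
    unfolding lp_optimal_def is_arg_max_def chebyshev_lp_feasible_iff[symmetric]
    by (auto simp: chebyshev_lp_def not_less)
  then show ?thesis
    by (simp add: chebyshev_centre_def)
qed

lemma closed_satisfies_system: "closed {x. satisfies_ineqs D x \<and> satisfies_eqs D x}"
proof -
  have "{x. satisfies_ineqs D x \<and> satisfies_eqs D x} =
      (\<Inter>(c, d)\<in>set (fst D). {x. c \<bullet> x \<le> d}) \<inter> (\<Inter>(e, f)\<in>set (snd D). {x. e \<bullet> x = f})"
    by (auto simp: satisfies_ineqs_def satisfies_eqs_def)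
  also have "closed \<dots>"
    by (auto intro!: closed_INT closed_Int closed_halfspace_le closed_hyperplane)
  finally show ?thesis .
qed

text \<open>The box bounds both the centres and the radii of inscribed balls, so the feasible set is
  compact; a point of the polyhedron in the box is an inscribed ball of radius 0.\<close>

lemma chebyshev_lp_optimum_exists:
  fixes D :: "(real^'l::{finite,linorder}) lin_system"
  assumes "w0 \<in> orthant_polyhedron D \<inter> cbox lo hi"
  shows "\<exists>x. lp_optimal (chebyshev_lp D lo hi) x"
proof -
  let ?M = "chebyshev_lp D lo hi"
  define S where "S = {x. satisfies_ineqs (lp_system ?M) x \<and> satisfies_eqs (lp_system ?M) x}"
  have S: "(w, r) \<in> S \<longleftrightarrow> inscribed_ball D lo hi w r" for w r
    unfolding S_def using chebyshev_lp_feasible_iff by blast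
  have "S \<subseteq> cbox lo hi \<times> cball 0 (diameter (cbox lo hi))"
  proof
    fix x assume "x \<in> S"
    then obtain w r where x: "x = (w, r)" and ib: "inscribed_ball D lo hi w r"
      using S by (cases x) auto
    have r: "0 \<le> r" and sub: "cball w r \<subseteq> cbox lo hi"
      using ib by (auto simp: inscribed_ball_def)
    \<comment> \<open>A radius of the ball along any coordinate axis stays in the box.\<close>
    have "dist w (w + r *\<^sub>R axis undefined 1) \<le> diameter (cbox lo hi)"
      using r sub by (intro diameter_bounded_bound subsetD[OF sub]) (auto simp: dist_norm)
    then show "x \<in> cbox lo hi \<times> cball 0 (diameter (cbox lo hi))"
      using r sub by (auto simp: x dist_norm)
  qed
  then have "bounded S"
    by (rule bounded_subset[rotated]) (intro bounded_Times bounded_cbox bounded_cball)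
  then have "compact S"
    unfolding compact_eq_bounded_closed S_def using closed_satisfies_system by blast
  moreover have "(w0, 0) \<in> S"
    using assms by (simp add: S inscribed_ball_def orthant_polyhedron_def)
  moreover have "continuous_on S (\<lambda>x. lp_objective ?M \<bullet> x)"
    by (intro continuous_intros)
  ultimately obtain x where "x \<in> S" "\<forall>y\<in>S. lp_objective ?M \<bullet> y \<le> lp_objective ?M \<bullet> x"
    using continuous_attains_sup[of S] by blast
  then show ?thesis
    unfolding lp_optimal_def is_arg_max_def S_def by (intro exI[of _ x]) (auto simp: not_less)
qed

theorem mainTheorem8:
  fixes K :: nat and P :: "nat \<Rightarrow> ('a::euclidean_space, 'l::{finite,linorder}) problem"
  assumes "1 \<le> K"
    and "\<And>q. q \<in> {1..K} \<Longrightarrow> well_formed (P q)"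
    and "\<And>q. q \<in> {1..K} \<Longrightarrow> existence_assms (P q)"
    and "\<And>q. q \<in> {1..K} \<Longrightarrow> uniqueness_assm (P q)"
    and "\<And>q. q \<in> {1..K} \<Longrightarrow> convexity_assms (P q)"
  shows "(\<forall>w\<in>robust_region K P. \<forall>q\<in>{1..K}. weighted_optimal (P q) w (lex_optimum (P q))) \<and>
    ((\<forall>q\<in>{1..K}. is_orthant_polyhedron (equiv_region (P q)))
       \<longrightarrow> is_orthant_polyhedron (robust_region K P)) \<and>
    ((\<forall>q\<in>{1..K}. polyhedral_data (P q))
       \<longrightarrow> (\<forall>q\<in>{1..K}. is_orthant_polyhedron (equiv_region (P q))) \<and>
           is_orthant_polyhedron (robust_region K P)) \<and>
    (\<forall>D lo hi. (\<forall>q\<in>{1..K}. equiv_region (P q) = orthant_polyhedron (D q)) \<and> lo \<in> pos_orthant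
       \<longrightarrow> robust_region K P = orthant_polyhedron (stacked_system K D) \<and>
           (\<forall>w. chebyshev_centre (stacked_system K D) lo hi w \<longleftrightarrow>
                (\<exists>r. lp_optimal (chebyshev_lp (stacked_system K D) lo hi) (w, r))) \<and>
           (robust_region K P \<inter> cbox lo hi \<noteq> {} \<longrightarrow>
                (\<exists>x. lp_optimal (chebyshev_lp (stacked_system K D) lo hi) x)))"
proof -
  have stacked: "robust_region K P = orthant_polyhedron (stacked_system K D)"
    if "\<forall>q\<in>{1..K}. equiv_region (P q) = orthant_polyhedron (D q)" for D
    using that stacked_orthant_polyhedron[OF assms(1), of D] by (simp add: robust_region_def)
  have optimal: "\<forall>w\<in>robust_region K P. \<forall>q\<in>{1..K}. weighted_optimal (P q) w (lex_optimum (P q))"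
    using equiv_region_eq[OF assms(3)] lex_optimum_feasible[OF assms(3)]
    by (fastforce simp: robust_region_def weighted_optimal_def is_arg_min_def not_less)
  have robust: "is_orthant_polyhedron (robust_region K P)"
    if "\<forall>q\<in>{1..K}. is_orthant_polyhedron (equiv_region (P q))"
    using that stacked unfolding is_orthant_polyhedron_def by metis
  have region: "\<forall>q\<in>{1..K}. is_orthant_polyhedron (equiv_region (P q))"
    if "\<forall>q\<in>{1..K}. polyhedral_data (P q)"
    using that assms(2,3,5) by (blast intro: equiv_region_polyhedron)
  have "\<exists>x. lp_optimal (chebyshev_lp (stacked_system K D) lo hi) x"
    if "\<forall>q\<in>{1..K}. equiv_region (P q) = orthant_polyhedron (D q)"
      and "robust_region K P \<inter> cbox lo hi \<noteq> {}" for D lo hi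
    using that stacked chebyshev_lp_optimum_exists by blast
  then show ?thesis
    using optimal robust region stacked chebyshev_centre_iff_lp by blast
qed

end
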